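(* Let $X$ be a set of seeds (closed under isomorphism) all of which are primitive, and let $G$ be the garden of $X$. Let $O(x)=\sum_n o_n x^n$, where $o_n$ is the number of isomorphism classes of $n$-element posets in $G$; let $E(x)=\sum_n e_n x^n/n!$, where $e_n$ is the number of posets on the vertex set $[n]$ belonging to $G$; and let $S(x)=\sum_n s_n x^n/n!$, where $s_n$ is the number of posets on $[n]$ belonging to $X$. Then \[E(x)=S(e^x-1),\qquad E(x)=O(1-e^{-x}),\qquad O(x)=S\!\left(\frac{x}{1-x}\right).\]
   Context: All posets are finite. Two incomparable elements $x,x'$ of a poset $P$ are exchangeable if for all $y\in P$: $x<y$ iff $x'<y$, and $x>y$ iff $x'>y$. Cloning at $x$ produces a poset $P'$ obtained by adding a new element $x'$ exchangeable with $x$. A seed is a poset with no pair of exchangeable elements. $P$ is a sprout of $Q$ if $P$ can be obtained from $Q$ by a finite (possibly empty) sequence of cloning operations. The garden of a set $X$ of seeds is the set of all sprouts of members of $X$. A poset is primitive if it has no nontrivial automorphism. *)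

theory Defs
  imports "HOL-Computational_Algebra.Formal_Power_Series"
begin

text \<open>
  A poset is represented by its reflexive order relation \<open>P\<close>; its set of elements is \<open>Field P\<close>
  and \<open>(x, y) \<in> P\<close> means \<open>x \<le> y\<close>. The empty relation is the empty poset.
\<close>

definition finite_poset :: "'a rel \<Rightarrow> bool" where
  "finite_poset P \<longleftrightarrow> Partial_order P \<and> finite (Field P)"

definition strictly_below :: "'a rel \<Rightarrow> 'a \<Rightarrow> 'a \<Rightarrow> bool" where
  "strictly_below P x y \<longleftrightarrow> (x, y) \<in> P \<and> x \<noteq> y"

definition poset_isomorphism :: "('a \<Rightarrow> 'b) \<Rightarrow> 'a rel \<Rightarrow> 'b rel \<Rightarrow> bool" where
  "poset_isomorphism f P Q \<longleftrightarrow> bij_betw f (Field P) (Field Q) \<and>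
     (\<forall>x\<in>Field P. \<forall>y\<in>Field P. (x, y) \<in> P \<longleftrightarrow> (f x, f y) \<in> Q)"

definition isomorphic_posets :: "'a rel \<Rightarrow> 'b rel \<Rightarrow> bool" where
  "isomorphic_posets P Q \<longleftrightarrow> (\<exists>f. poset_isomorphism f P Q)"

definition primitive :: "'a rel \<Rightarrow> bool" where
  "primitive P \<longleftrightarrow> (\<forall>f. poset_isomorphism f P P \<longrightarrow> (\<forall>x\<in>Field P. f x = x))"

definition exchangeable :: "'a rel \<Rightarrow> 'a \<Rightarrow> 'a \<Rightarrow> bool" where
  "exchangeable P x x' \<longleftrightarrow> x \<in> Field P \<and> x' \<in> Field P \<and> (x, x') \<notin> P \<and> (x', x) \<notin> P \<and>
     (\<forall>y\<in>Field P. (strictly_below P x y \<longleftrightarrow> strictly_below P x' y) \<and>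
                  (strictly_below P y x \<longleftrightarrow> strictly_below P y x'))"

definition seed :: "'a rel \<Rightarrow> bool" where
  "seed P \<longleftrightarrow> finite_poset P \<and> \<not> (\<exists>x x'. exchangeable P x x')"

definition cloning :: "'a rel \<Rightarrow> 'a rel \<Rightarrow> bool" where
  "cloning P P' \<longleftrightarrow> finite_poset P \<and> finite_poset P' \<and>
     (\<exists>x\<in>Field P. \<exists>x'. x' \<notin> Field P \<and> Field P' = insert x' (Field P) \<and>
        P = P' \<inter> Field P \<times> Field P \<and> exchangeable P' x x')"

text \<open>\<open>sprout_of P Q\<close>: the poset \<open>P\<close> is a sprout of \<open>Q\<close>.\<close>

definition sprout_of :: "'a rel \<Rightarrow> 'a rel \<Rightarrow> bool" where
  "sprout_of P Q \<longleftrightarrow> cloning\<^sup>*\<^sup>* Q P"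

definition garden :: "'a rel set \<Rightarrow> 'a rel set" where
  "garden X = {P. \<exists>Q\<in>X. sprout_of P Q}"

text \<open>
  Every finite poset is isomorphic to one whose elements are natural numbers, so classes of finite
  posets closed under isomorphism are represented by sets of orders on finite subsets of \<open>nat\<close>.
  The vertex set \<open>[n]\<close> is \<open>{1..n}\<close>.
\<close>

definition iso_classes :: "nat rel set \<Rightarrow> nat \<Rightarrow> nat rel set set" where
  "iso_classes A n = {P \<in> A. card (Field P) = n} // {(P, Q). isomorphic_posets P Q}"

definition labelled_posets :: "nat rel set \<Rightarrow> nat \<Rightarrow> nat rel set" where
  "labelled_posets A n = {P \<in> A. Field P = {1..n}}"

definition ogf :: "nat rel set \<Rightarrow> rat fps" where
  "ogf A = Abs_fps (\<lambda>n. of_nat (card (iso_classes A n)))"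

definition egf :: "nat rel set \<Rightarrow> rat fps" where
  "egf A = Abs_fps (\<lambda>n. of_nat (card (labelled_posets A n)) / fact n)"

end

theory Submission
  imports Defs "HOL-Combinatorics.Permutations" "HOL-Library.Nat_Bijection"
begin

text \<open>
  A sprout of a seed \<open>Q\<close> is a blow-up of \<open>Q\<close> along a surjection \<open>f\<close> onto \<open>Q\<close>: every vertex is replaced
  by an antichain of clones. The fibres of \<open>f\<close> are the classes of equal or exchangeable elements of
  the blow-up, so the blow-up determines \<open>(Q, f)\<close> up to a unique isomorphism of seeds. Hence every
  labelled sprout on \<open>{1..n}\<close> arises from exactly \<open>k!\<close> pairs of a seed on \<open>{1..k}\<close> and a surjection
  \<open>{1..n} \<rightarrow> {1..k}\<close>, which gives \<open>E(x) = S(e^x - 1)\<close>. An isomorphism class of sprouts only remembers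
  the sizes of the fibres; since primitive seeds have no automorphisms, it arises from exactly \<open>k!\<close>
  pairs of a seed on \<open>{1..k}\<close> and a composition of \<open>n\<close> into \<open>k\<close> positive parts, which gives
  \<open>O(x) = S(x / (1 - x))\<close>. The remaining identity follows by substituting \<open>1 - e^(-x)\<close> for \<open>x\<close>.
\<close>

unbundle fps_syntax

subsection \<open>Isomorphisms and blow-ups\<close>

text \<open>The target of an isomorphism can be recovered from the source and the map, so
  relabelling a poset by a permutation becomes an image of relations.\<close>

lemma poset_isomorphism_iff_image:
  "poset_isomorphism f P Q \<longleftrightarrow> inj_on f (Field P) \<and> Q = map_prod f f ` P"
proof
  assume iso: "poset_isomorphism f P Q"
  then have "inj_on f (Field P)" "f ` Field P = Field Q"
    and rel: "\<And>x y. x \<in> Field P \<Longrightarrow> y \<in> Field P \<Longrightarrow> (x, y) \<in> P \<longleftrightarrow> (f x, f y) \<in> Q"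
    by (auto simp: poset_isomorphism_def bij_betw_def)
  moreover have "Q \<subseteq> map_prod f f ` P"
  proof
    fix z assume "z \<in> Q"
    then obtain u v where z: "z = (u, v)" "(u, v) \<in> Q" "u \<in> Field Q" "v \<in> Field Q"
      by (metis FieldI1 FieldI2 surj_pair)
    then obtain x y where "x \<in> Field P" "y \<in> Field P" "u = f x" "v = f y"
      using \<open>f ` Field P = Field Q\<close> by blast
    then show "z \<in> map_prod f f ` P"
      using z rel by force
  qed
  moreover have "map_prod f f ` P \<subseteq> Q"
    using rel by (auto intro: FieldI1 FieldI2)
  ultimately show "inj_on f (Field P) \<and> Q = map_prod f f ` P" by blast
next
  assume *: "inj_on f (Field P) \<and> Q = map_prod f f ` P"
  then have "Field Q = f ` Field P"
    by (force simp: Field_def)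
  moreover have "(x, y) \<in> P \<longleftrightarrow> (f x, f y) \<in> Q" if "x \<in> Field P" "y \<in> Field P" for x y
  proof
    assume "(f x, f y) \<in> Q"
    then obtain u v where "(u, v) \<in> P" "f u = f x" "f v = f y" using * by auto
    then show "(x, y) \<in> P"
      using * that by (metis FieldI1 FieldI2 inj_onD)
  qed (use * in force)
  ultimately show "poset_isomorphism f P Q"
    using * by (auto simp: poset_isomorphism_def bij_betw_def)
qed

lemma poset_isomorphism_comp:
  assumes "poset_isomorphism f P Q" "poset_isomorphism g Q R"
  shows "poset_isomorphism (g \<circ> f) P R"
  using assms unfolding poset_isomorphism_def
  by (auto intro: bij_betw_trans simp: bij_betw_apply)

lemma poset_isomorphism_inv:
  assumes "poset_isomorphism f P Q"
  shows "poset_isomorphism (inv_into (Field P) f) Q P"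
  using assms unfolding poset_isomorphism_def
  by (auto intro: bij_betw_inv_into simp: bij_betw_inv_into_right bij_betw_apply[OF bij_betw_inv_into])

lemma isomorphic_posets_refl: "isomorphic_posets P P"
  by (auto simp: isomorphic_posets_def poset_isomorphism_def intro!: exI[of _ id])

lemma isomorphic_posets_sym: "isomorphic_posets P Q \<Longrightarrow> isomorphic_posets Q P"
  unfolding isomorphic_posets_def using poset_isomorphism_inv by blast

lemma isomorphic_posets_trans:
  "isomorphic_posets P Q \<Longrightarrow> isomorphic_posets Q R \<Longrightarrow> isomorphic_posets P R"
  unfolding isomorphic_posets_def using poset_isomorphism_comp by blast

lemma isomorphic_posets_card: "isomorphic_posets P Q \<Longrightarrow> card (Field P) = card (Field Q)"
  by (auto simp: isomorphic_posets_def poset_isomorphism_def bij_betw_same_card)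

text \<open>The relation \<open>Q\<close> is consulted only between different fibres: it is
  reflexive for a poset, so without \<open>f a \<noteq> f b\<close> all points of a fibre would be
  mutually related instead of forming an antichain.\<close>

definition blow_up :: "'b rel \<Rightarrow> ('a \<Rightarrow> 'b) \<Rightarrow> 'a set \<Rightarrow> 'a rel" where
  "blow_up Q f A = {(a, b). a \<in> A \<and> b \<in> A \<and> (a = b \<or> f a \<noteq> f b \<and> (f a, f b) \<in> Q)}"

lemma in_blow_up_iff:
  "(a, b) \<in> blow_up Q f A \<longleftrightarrow> a \<in> A \<and> b \<in> A \<and> (a = b \<or> f a \<noteq> f b \<and> (f a, f b) \<in> Q)"
  by (simp add: blow_up_def)

lemma Field_blow_up [simp]: "Field (blow_up Q f A) = A"
  by (auto simp: blow_up_def Field_def)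

lemma blow_up_cong:
  "(\<And>a. a \<in> A \<Longrightarrow> f a = g a) \<Longrightarrow> blow_up Q f A = blow_up Q g A"
  by (auto simp: blow_up_def)

lemma blow_up_restrict: "B \<subseteq> A \<Longrightarrow> blow_up Q f A \<inter> B \<times> B = blow_up Q f B"
  by (auto simp: blow_up_def)

text \<open>An isomorphism of the base poset preserves both data that a blow-up reads off: whether
  two images differ and how they compare.\<close>

lemma blow_up_image:
  assumes "poset_isomorphism \<sigma> Q Q'" "f ` A \<subseteq> Field Q"
  shows "blow_up Q' (\<sigma> \<circ> f) A = blow_up Q f A"
proof -
  have "inj_on \<sigma> (Field Q)"
    and "\<And>x y. x \<in> Field Q \<Longrightarrow> y \<in> Field Q \<Longrightarrow> (x, y) \<in> Q \<longleftrightarrow> (\<sigma> x, \<sigma> y) \<in> Q'"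
    using assms by (auto simp: poset_isomorphism_def bij_betw_def)
  then show ?thesis
    using assms(2) by (auto simp: in_blow_up_iff image_subset_iff inj_on_eq_iff)
qed

text \<open>Pulling the points of \<open>R\<close> back along \<open>g\<close> carries the fibres
  over, so an isomorphic copy of a blow-up is again a blow-up of the same \<open>Q\<close>.\<close>

lemma poset_isomorphism_blow_up:
  assumes "poset_isomorphism g (blow_up Q f A) R"
  shows "R = blow_up Q (f \<circ> inv_into A g) (Field R)"
proof -
  define h where "h = inv_into A g"
  have h: "bij_betw h (Field R) A"
      "\<And>x y. x \<in> Field R \<Longrightarrow> y \<in> Field R \<Longrightarrow> (x, y) \<in> R \<longleftrightarrow> (h x, h y) \<in> blow_up Q f A"
    using poset_isomorphism_inv[OF assms] by (auto simp: h_def poset_isomorphism_def)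
  then have "x = y \<longleftrightarrow> h x = h y" if "x \<in> Field R" "y \<in> Field R" for x y
    using that by (auto simp: bij_betw_def inj_on_def)
  then have "(x, y) \<in> R \<longleftrightarrow> (x, y) \<in> blow_up Q (f \<circ> h) (Field R)" for x y
    using h bij_betw_apply[OF h(1)]
    by (cases "x \<in> Field R \<and> y \<in> Field R") (auto simp: in_blow_up_iff intro: FieldI1 FieldI2)
  then show ?thesis unfolding h_def by auto
qed

lemma isomorphic_blow_ups:
  assumes "bij_betw g A B" "\<And>a. a \<in> A \<Longrightarrow> f' (g a) = f a"
  shows "isomorphic_posets (blow_up Q f A) (blow_up Q f' B)"
  unfolding isomorphic_posets_def
proof (intro exI)
  show "poset_isomorphism g (blow_up Q f A) (blow_up Q f' B)"
    using assms unfolding poset_isomorphism_def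
    by (auto simp: in_blow_up_iff bij_betw_def inj_on_eq_iff)
qed

lemma finite_poset_blow_up:
  assumes Q: "Partial_order Q" and "finite A"
  shows "finite_poset (blow_up Q f A)"
proof -
  have tr: "trans Q" and as: "antisym Q"
    using Q by (auto simp: partial_order_on_def preorder_on_def)
  have "trans (blow_up Q f A)"
  proof (rule transI)
    fix x y z assume *: "(x, y) \<in> blow_up Q f A" "(y, z) \<in> blow_up Q f A"
    consider "x = y" | "y = z" | "f x \<noteq> f y" "f y \<noteq> f z" "(f x, f y) \<in> Q" "(f y, f z) \<in> Q"
      using * by (auto simp: blow_up_def)
    then show "(x, z) \<in> blow_up Q f A"
    proof cases
      \<comment> \<open>If \<open>f x = f z\<close>, then \<open>f x\<close> and \<open>f y\<close>
        would lie below each other in \<open>Q\<close>, against antisymmetry.\<close>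
      case 3
      then have "f x \<noteq> f z" "(f x, f z) \<in> Q"
        using antisymD[OF as] transD[OF tr] by metis+
      then show ?thesis using * by (auto simp: blow_up_def)
    qed (use * in auto)
  qed
  moreover have "antisym (blow_up Q f A)"
    using as unfolding antisym_def blow_up_def by auto
  moreover have "refl_on A (blow_up Q f A)" "blow_up Q f A \<subseteq> A \<times> A"
    by (auto simp: blow_up_def refl_on_def)
  ultimately show ?thesis
    using \<open>finite A\<close> by (auto simp: finite_poset_def partial_order_on_def preorder_on_def)
qed

lemma blow_up_ident:
  assumes "Partial_order Q"
  shows "blow_up Q (\<lambda>x. x) (Field Q) = Q"
proof -
  have "\<And>x. x \<in> Field Q \<Longrightarrow> (x, x) \<in> Q"
    using assms by (simp add: partial_order_on_def preorder_on_def refl_on_def)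
  moreover have "Q \<subseteq> Field Q \<times> Field Q"
    by (auto intro: FieldI1 FieldI2)
  ultimately show ?thesis
    unfolding blow_up_def by blast
qed

section \<open>Recovering the seed from a blow-up\<close>

lemma exchangeable_blow_up:
  assumes "a \<in> A" "b \<in> A" "a \<noteq> b" "f a = f b"
  shows "exchangeable (blow_up Q f A) a b"
  using assms by (auto simp: exchangeable_def strictly_below_def in_blow_up_iff)

text \<open>Every element of \<open>Q\<close> lifts to a point of \<open>A\<close>, so exchangeable
  points with distinct images would make these images exchangeable in the seed. Hence the fibres of
  \<open>f\<close> are visible in the blow-up alone.\<close>

lemma exchangeable_blow_up_iff:
  assumes Q: "seed Q" and f: "f ` A = Field Q" and ab: "a \<in> A" "b \<in> A"
  shows "f a = f b \<longleftrightarrow> a = b \<or> exchangeable (blow_up Q f A) a b"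
proof
  show "f a = f b \<Longrightarrow> a = b \<or> exchangeable (blow_up Q f A) a b"
    using exchangeable_blow_up ab by metis
next
  assume *: "a = b \<or> exchangeable (blow_up Q f A) a b"
  show "f a = f b"
  proof (rule ccontr)
    assume ne: "f a \<noteq> f b"
    with * have ex: "exchangeable (blow_up Q f A) a b" by auto
    have nr: "(f a, f b) \<notin> Q" "(f b, f a) \<notin> Q"
      using ex ne ab by (auto simp: exchangeable_def blow_up_def)
    have "(strictly_below Q (f a) y \<longleftrightarrow> strictly_below Q (f b) y) \<and>
          (strictly_below Q y (f a) \<longleftrightarrow> strictly_below Q y (f b))" if "y \<in> Field Q" for y
    proof -
      obtain c where c: "c \<in> A" "y = f c" using \<open>y \<in> Field Q\<close> f by auto
      then have "(strictly_below (blow_up Q f A) a c \<longleftrightarrow> strictly_below (blow_up Q f A) b c) \<and>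
          (strictly_below (blow_up Q f A) c a \<longleftrightarrow> strictly_below (blow_up Q f A) c b)"
        using ex by (auto simp: exchangeable_def)
      then show ?thesis
        using c nr ab unfolding strictly_below_def in_blow_up_iff by metis
    qed
    then have "exchangeable Q (f a) (f b)"
      using nr ab f unfolding exchangeable_def by blast
    with Q show False by (auto simp: seed_def)
  qed
qed

text \<open>Equal blow-ups have the same exchangeable pairs, so \<open>f\<close> and
  \<open>f'\<close> have the same fibres and sending \<open>f a\<close> to \<open>f' a\<close> is
  well defined. Comparisons between distinct fibres are read off from any representatives.\<close>

lemma poset_isomorphism_of_blow_up_eq:
  assumes Q: "seed Q" "f ` A = Field Q" and Q': "seed Q'" "f' ` A = Field Q'"
    and eq: "blow_up Q f A = blow_up Q' f' A"
  obtains \<sigma> where "poset_isomorphism \<sigma> Q Q'" "\<And>a. a \<in> A \<Longrightarrow> f' a = \<sigma> (f a)"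
proof
  define \<sigma> where "\<sigma> = f' \<circ> inv_into A f"
  have ker: "f a = f b \<longleftrightarrow> f' a = f' b" if "a \<in> A" "b \<in> A" for a b
    using exchangeable_blow_up_iff[OF Q that] exchangeable_blow_up_iff[OF Q' that] eq by simp
  show \<sigma>: "f' a = \<sigma> (f a)" if "a \<in> A" for a
  proof -
    have "inv_into A f (f a) \<in> A" "f (inv_into A f (f a)) = f a"
      using that by (auto simp: inv_into_into f_inv_into_f)
    then have "f' a = f' (inv_into A f (f a))" using ker that by metis
    then show ?thesis by (simp add: \<sigma>_def)
  qed
  have refl: "\<And>x. x \<in> Field Q \<Longrightarrow> (x, x) \<in> Q" "\<And>x. x \<in> Field Q' \<Longrightarrow> (x, x) \<in> Q'"
    using Q(1) Q'(1)
    by (simp_all add: seed_def finite_poset_def partial_order_on_def preorder_on_def refl_on_def)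
  have "inj_on \<sigma> (Field Q)"
    unfolding Q(2)[symmetric] inj_on_def using ker \<sigma> by (metis imageE)
  moreover have "\<sigma> ` Field Q = Field Q'"
    unfolding Q(2)[symmetric] Q'(2)[symmetric] image_image using \<sigma> by (intro image_cong) auto
  moreover have "(x, y) \<in> Q \<longleftrightarrow> (\<sigma> x, \<sigma> y) \<in> Q'" if xy: "x \<in> Field Q" "y \<in> Field Q" for x y
  proof -
    obtain a b where ab: "a \<in> A" "b \<in> A" "x = f a" "y = f b" using xy Q(2) by (metis imageE)
    show ?thesis
    proof (cases "f a = f b")
      \<comment> \<open>Within one fibre the blow-up carries no information on \<open>Q\<close>;
        both sides hold by reflexivity.\<close>
      case True
      moreover have "\<sigma> x \<in> Field Q'" using that \<open>\<sigma> ` Field Q = Field Q'\<close> by blast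
      ultimately show ?thesis using ab that refl by simp
    next
      case False
      then have "f' a \<noteq> f' b" using ker ab by simp
      have "(a, b) \<in> blow_up Q f A \<longleftrightarrow> (a, b) \<in> blow_up Q' f' A" using eq by simp
      then show ?thesis 
        using False \<open>f' a \<noteq> f' b\<close> ab \<sigma>[of a] \<sigma>[of b] by (auto simp: in_blow_up_iff)
    qed
  qed
  ultimately show "poset_isomorphism \<sigma> Q Q'"
    by (auto simp: poset_isomorphism_def bij_betw_def)
qed

text \<open>Fibres of equal size are matched separately, and the local bijections glue because the
  fibres partition both sets.\<close>

lemma bij_betw_of_card_fibres:
  assumes "finite A" "finite B"
    and card: "\<And>q. card {a \<in> A. f a = q} = card {b \<in> B. f' b = q}"
  obtains g where "bij_betw g A B" "\<And>a. a \<in> A \<Longrightarrow> f' (g a) = f a"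
proof -
  have "\<exists>h. bij_betw h {a \<in> A. f a = q} {b \<in> B. f' b = q}" for q
    using assms by (intro finite_same_card_bij) auto
  then obtain h where h: "\<And>q. bij_betw (h q) {a \<in> A. f a = q} {b \<in> B. f' b = q}" by metis
  define g where "g a = h (f a) a" for a
  have gA: "g a \<in> B \<and> f' (g a) = f a" if "a \<in> A" for a
    using bij_betw_apply[OF h[of "f a"], of a] that by (auto simp: g_def)
  have "inj_on g A"
  proof (rule inj_onI)
    fix a b assume *: "a \<in> A" "b \<in> A" "g a = g b"
    then have "f a = f b" using gA by metis
    then show "a = b"
      using * bij_betw_imp_inj_on[OF h[of "f a"]] by (auto simp: g_def inj_on_def)
  qed
  moreover have "B \<subseteq> g ` A"
  proof
    fix b assume "b \<in> B"
    then have "b \<in> h (f' b) ` {a \<in> A. f a = f' b}"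
      using bij_betw_imp_surj_on[OF h[of "f' b"]] by auto
    then show "b \<in> g ` A" by (force simp: g_def)
  qed
  ultimately have "bij_betw g A B" using gA by (auto simp: bij_betw_def)
  then show ?thesis using gA that by blast
qed

text \<open>Transporting one blow-up to \<open>B\<close> yields two presentations of the same poset,
  and these differ by an isomorphism of seeds. Conversely, equal fibre sizes allow a bijection that
  respects fibres.\<close>

lemma isomorphic_blow_ups_iff:
  assumes Q: "seed Q" "f ` A = Field Q" and Q': "seed Q'" "f' ` B = Field Q'"
    and fin: "finite A" "finite B"
  shows "isomorphic_posets (blow_up Q f A) (blow_up Q' f' B) \<longleftrightarrow>
    (\<exists>\<sigma>. poset_isomorphism \<sigma> Q Q' \<and>
      (\<forall>q\<in>Field Q. card {b \<in> B. f' b = \<sigma> q} = card {a \<in> A. f a = q}))"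
proof
  assume "isomorphic_posets (blow_up Q f A) (blow_up Q' f' B)"
  then obtain g where g: "poset_isomorphism g (blow_up Q f A) (blow_up Q' f' B)"
    by (auto simp: isomorphic_posets_def)
  then have bij: "bij_betw g A B" by (simp add: poset_isomorphism_def)
  define h where "h = inv_into A g"
  have h: "bij_betw h B A" using bij by (simp add: h_def bij_betw_inv_into)
  have eq: "blow_up Q (f \<circ> h) B = blow_up Q' f' B"
    using poset_isomorphism_blow_up[OF g] by (simp add: h_def)
  have "(f \<circ> h) ` B = Field Q"
    using h Q(2) by (metis bij_betw_imp_surj_on image_comp)
  then obtain \<sigma> where \<sigma>: "poset_isomorphism \<sigma> Q Q'" "\<And>b. b \<in> B \<Longrightarrow> f' b = \<sigma> (f (h b))"
    using poset_isomorphism_of_blow_up_eq[OF Q(1) _ Q' eq] by auto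
  have "card {b \<in> B. f' b = \<sigma> q} = card {a \<in> A. f a = q}" if "q \<in> Field Q" for q
  proof -
    have "f' b = \<sigma> q \<longleftrightarrow> f (h b) = q" if "b \<in> B" for b
    proof -
      have "f (h b) \<in> Field Q" using that h Q(2) by (auto simp: bij_betw_def)
      then show ?thesis
        using \<sigma> that \<open>q \<in> Field Q\<close> by (auto simp: poset_isomorphism_def bij_betw_def inj_on_def)
    qed
    then have "bij_betw h {b \<in> B. f' b = \<sigma> q} {a \<in> A. f a = q}"
      using h by (auto simp: bij_betw_def inj_on_def image_iff)
    then show ?thesis by (rule bij_betw_same_card)
  qed
  with \<sigma> show "\<exists>\<sigma>. poset_isomorphism \<sigma> Q Q' \<and>
      (\<forall>q\<in>Field Q. card {b \<in> B. f' b = \<sigma> q} = card {a \<in> A. f a = q})" by blast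
next
  assume "\<exists>\<sigma>. poset_isomorphism \<sigma> Q Q' \<and>
      (\<forall>q\<in>Field Q. card {b \<in> B. f' b = \<sigma> q} = card {a \<in> A. f a = q})"
  then obtain \<sigma> where \<sigma>: "poset_isomorphism \<sigma> Q Q'"
    and card: "\<And>q. q \<in> Field Q \<Longrightarrow> card {b \<in> B. f' b = \<sigma> q} = card {a \<in> A. f a = q}" by blast
  have bij: "bij_betw \<sigma> (Field Q) (Field Q')" using \<sigma> by (simp add: poset_isomorphism_def)
  \<comment> \<open>The gluing lemma asks for every value \<open>q'\<close>, so values outside the
    seed, with both fibres empty, are covered too.\<close>
  have fibres: "card {a \<in> A. (\<sigma> \<circ> f) a = q'} = card {b \<in> B. f' b = q'}" for q'
  proof (cases "q' \<in> Field Q'")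
    case True
    then obtain q where q: "q \<in> Field Q" "q' = \<sigma> q" using bij by (auto simp: bij_betw_def)
    then have "{a \<in> A. (\<sigma> \<circ> f) a = q'} = {a \<in> A. f a = q}"
      using bij Q(2) by (auto simp: bij_betw_def inj_on_def)
    then show ?thesis using card q by simp
  next
    case False
    moreover have "(\<sigma> \<circ> f) ` A = Field Q'"
      using Q(2) bij by (metis bij_betw_imp_surj_on image_comp)
    ultimately have "{a \<in> A. (\<sigma> \<circ> f) a = q'} = {}" "{b \<in> B. f' b = q'} = {}"
      using Q'(2) by blast+
    then show ?thesis by (simp only: card.empty)
  qed
  obtain g where "bij_betw g A B" "\<And>a. a \<in> A \<Longrightarrow> f' (g a) = (\<sigma> \<circ> f) a"
    using bij_betw_of_card_fibres[OF fin fibres] by metis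
  then have "isomorphic_posets (blow_up Q' (\<sigma> \<circ> f) A) (blow_up Q' f' B)"
    by (rule isomorphic_blow_ups)
  then show "isomorphic_posets (blow_up Q f A) (blow_up Q' f' B)"
    using blow_up_image[OF \<sigma>, of f A] Q(2) by simp
qed

subsection \<open>The garden as a class of blow-ups\<close>

text \<open>A point added to a nonempty fibre is exchangeable with the points already there.\<close>

lemma cloning_blow_up:
  assumes Q: "Partial_order Q" and "finite A" "a' \<notin> A" "a \<in> A" "f a = f a'"
  shows "cloning (blow_up Q f A) (blow_up Q f (insert a' A))"
proof -
  have "finite_poset (blow_up Q f A)" "finite_poset (blow_up Q f (insert a' A))"
    using assms by (auto intro!: finite_poset_blow_up)
  moreover have "exchangeable (blow_up Q f (insert a' A)) a a'"
    using assms by (intro exchangeable_blow_up) auto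
  moreover have "blow_up Q f A = blow_up Q f (insert a' A) \<inter> A \<times> A"
    using blow_up_restrict[of A "insert a' A" Q f] by auto
  ultimately show ?thesis 
    unfolding cloning_def Field_blow_up using assms by blast
qed

text \<open>Sending the new point to the image of the point it copies extends the presentation and
  leaves the image unchanged.\<close>

lemma cloning_imp_blow_up:
  assumes "cloning (blow_up Q f A) P'"
  obtains f' where "P' = blow_up Q f' (Field P')" "f' ` Field P' = f ` A" "finite (Field P')"
proof -
  obtain x x' where x: "x \<in> A" "x' \<notin> A" "Field P' = insert x' A"
    and P: "blow_up Q f A = P' \<inter> A \<times> A" and ex: "exchangeable P' x x'"
    and fp: "finite_poset P'"
    using assms unfolding cloning_def by auto
  define f' where "f' = f(x' := f x)"
  have refl: "(x', x') \<in> P'"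
    using fp x by (auto simp: finite_poset_def partial_order_on_def preorder_on_def refl_on_def)
  have old: "(y, z) \<in> P' \<longleftrightarrow> y = z \<or> f y \<noteq> f z \<and> (f y, f z) \<in> Q" if "y \<in> A" "z \<in> A" for y z
  proof -
    have "(y, z) \<in> P' \<longleftrightarrow> (y, z) \<in> blow_up Q f A" using P that by auto
    then show ?thesis using that by (simp add: blow_up_def)
  qed
  \<comment> \<open>Exchangeability transfers the comparisons of \<open>x\<close> to
    \<open>x'\<close>; for \<open>y = x\<close> both sides are false.\<close>
  have new: "(x', y) \<in> P' \<longleftrightarrow> f x \<noteq> f y \<and> (f x, f y) \<in> Q"
      "(y, x') \<in> P' \<longleftrightarrow> f y \<noteq> f x \<and> (f y, f x) \<in> Q" if "y \<in> A" for y
  proof -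
    have "x' \<noteq> y" using that x by auto
    have sb: "strictly_below P' x y \<longleftrightarrow> strictly_below P' x' y"
      "strictly_below P' y x \<longleftrightarrow> strictly_below P' y x'"
      "(x, x') \<notin> P'" "(x', x) \<notin> P'"
      using ex that x by (auto simp: exchangeable_def)
    show "(x', y) \<in> P' \<longleftrightarrow> f x \<noteq> f y \<and> (f x, f y) \<in> Q"
      "(y, x') \<in> P' \<longleftrightarrow> f y \<noteq> f x \<and> (f y, f x) \<in> Q"
      using sb old[OF x(1) that] old[OF that x(1)] \<open>x' \<noteq> y\<close>
      by (auto simp: strictly_below_def)
  qed
  have "(y, z) \<in> P' \<longleftrightarrow> (y, z) \<in> blow_up Q f' (Field P')" for y z
  proof (cases "y \<in> Field P' \<and> z \<in> Field P'")
    case True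
    then show ?thesis using old new refl x
      by (cases "y = x'"; cases "z = x'") (auto simp: blow_up_def f'_def)
  next
    case False
    then show ?thesis by (auto simp: blow_up_def intro: FieldI1 FieldI2)
  qed
  then have "P' = blow_up Q f' (Field P')" by auto
  moreover have "f' ` Field P' = f ` A" using x by (auto simp: f'_def)
  moreover have "finite (Field P')" using fp by (simp add: finite_poset_def)
  ultimately show ?thesis using that by blast
qed

text \<open>Each cloning enlarges a fibre, so sprouts are blow-ups. Conversely, one point per fibre
  spans a copy of the seed, which lies in \<open>X\<close> by closure under isomorphism, and the
  remaining points are clones added one at a time.\<close>

lemma garden_iff_blow_up:
  fixes X :: "'a rel set"
  assumes seeds: "\<forall>P\<in>X. seed P"
    and iso_closed: "\<forall>P Q. P \<in> X \<and> isomorphic_posets P Q \<longrightarrow> Q \<in> X"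
  shows "P \<in> garden X \<longleftrightarrow>
    (\<exists>Q\<in>X. \<exists>f. finite (Field P) \<and> f ` Field P = Field Q \<and> P = blow_up Q f (Field P))"
proof
  assume "P \<in> garden X"
  then obtain Q where Q: "Q \<in> X" "cloning\<^sup>*\<^sup>* Q P" by (auto simp: garden_def sprout_of_def)
  have "\<exists>f. finite (Field P) \<and> f ` Field P = Field Q \<and> P = blow_up Q f (Field P)"
    using Q(2)
  proof (induction rule: rtranclp_induct)
    case base
    have "finite (Field Q)" "Partial_order Q"
      using Q(1) seeds by (auto simp: seed_def finite_poset_def)
    then show ?case using blow_up_ident[of Q] by (intro exI[of _ "\<lambda>x. x"]) simp
  next
    case (step P P')
    then obtain f where "f ` Field P = Field Q" "P = blow_up Q f (Field P)" by blast
    then show ?case using cloning_imp_blow_up[of Q f "Field P" P'] step.hyps(2) by metis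
  qed
  then show "\<exists>Q\<in>X. \<exists>f. finite (Field P) \<and> f ` Field P = Field Q \<and> P = blow_up Q f (Field P)"
    using Q(1) by blast
next
  assume "\<exists>Q\<in>X. \<exists>f. finite (Field P) \<and> f ` Field P = Field Q \<and> P = blow_up Q f (Field P)"
  then obtain Q f where Q: "Q \<in> X" and fin: "finite (Field P)"
    and f: "f ` Field P = Field Q" and P: "P = blow_up Q f (Field P)" by blast
  have po: "Partial_order Q" using Q seeds by (auto simp: seed_def finite_poset_def)
  \<comment> \<open>\<open>s\<close> chooses a point in each fibre, and \<open>R\<close> is the
    resulting transversal.\<close>
  define s where "s = inv_into (Field P) f"
  define R where "R = s ` Field Q"
  have s: "s q \<in> Field P" "f (s q) = q" if "q \<in> Field Q" for q
    using that f by (auto simp: s_def inv_into_into f_inv_into_f)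
  have R: "R \<subseteq> Field P" "f ` R = Field Q" using s by (auto simp: R_def image_iff)
  have "bij_betw s (Field Q) R"
    unfolding bij_betw_def R_def using s by (metis inj_on_def)
  then have "isomorphic_posets (blow_up Q (\<lambda>x. x) (Field Q)) (blow_up Q f R)"
    using s by (intro isomorphic_blow_ups[of s]) auto
  then have "blow_up Q f R \<in> X" using Q iso_closed blow_up_ident[OF po] by auto
  \<comment> \<open>\<open>D\<close> may overlap \<open>R\<close>; a point already present costs no
    cloning.\<close>
  moreover have "cloning\<^sup>*\<^sup>* (blow_up Q f R) (blow_up Q f (R \<union> D))"
    if "finite D" "D \<subseteq> Field P" for D
    using that
  proof (induction D rule: finite_induct)
    case (insert x' D)
    have "cloning\<^sup>*\<^sup>* (blow_up Q f (R \<union> D)) (blow_up Q f (R \<union> insert x' D))"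
    proof (cases "x' \<in> R \<union> D")
      case True
      then show ?thesis by (simp add: insert_absorb)
    next
      case False
      have "f x' \<in> f ` R" using insert.prems R f by auto
      then obtain x where "x \<in> R" "f x = f x'" by force
      moreover have "finite (R \<union> D)" using insert.hyps R fin finite_subset by blast
      ultimately have "cloning (blow_up Q f (R \<union> D)) (blow_up Q f (insert x' (R \<union> D)))"
        using False by (intro cloning_blow_up[OF po, of _ _ x]) auto
      then show ?thesis by auto
    qed
    then show ?case using insert.IH insert.prems by auto
  qed auto
  from this[of "Field P"] have "cloning\<^sup>*\<^sup>* (blow_up Q f R) P"
    using fin R P by (simp add: Un_absorb1)
  ultimately show "P \<in> garden X" by (auto simp: garden_def sprout_of_def)
qed

subsection \<open>Counting surjections and compositions\<close>

text \<open>In the applications the fibres of \<open>h\<close> are orbits of a free action of a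
  symmetric group, and \<open>m\<close> is its order \<open>fact k\<close>.\<close>

lemma card_eq_fibre_card_mult:
  assumes "finite A" "\<And>x. x \<in> A \<Longrightarrow> card {y \<in> A. h y = h x} = m"
  shows "card A = m * card (h ` A)"
proof -
  have "card A = (\<Sum>z\<in>h ` A. \<Sum>x\<in>{x \<in> A. h x = z}. 1)"
    using sum.image_gen[OF assms(1), of "\<lambda>_. 1::nat" h] by simp
  also have "\<dots> = (\<Sum>z\<in>h ` A. m)"
    using assms(2) by (intro sum.cong) auto
  finally show ?thesis by simp
qed

text \<open>This is the ordinary generating function of the possible sizes of a single
  fibre.\<close>

lemma fps_X_div_one_minus_fps_X:
  "fps_X / (1 - fps_X) = (Abs_fps (\<lambda>n. if n = 0 then 0 else 1) :: 'a :: field fps)"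
proof -
  have "fps_X / (1 - fps_X) = fps_X * inverse (1 - fps_X :: 'a fps)"
    by (rule fps_divide_unit) simp
  then show ?thesis
    by (simp add: fps_inverse_one_minus_fps_X fps_eq_iff)
qed

text \<open>Every map into \<open>B\<close> is a surjection onto exactly one subset
  \<open>C\<close>, and \<open>exp(|B| x)\<close> expands in the same way into powers of
  \<open>e^x - 1\<close>. Strong induction over subsets then isolates the term for
  \<open>C = B\<close>.\<close>

lemma card_surjections:
  assumes "finite A" "finite B"
  shows "(of_nat (card {f \<in> A \<rightarrow>\<^sub>E B. f ` A = B}) :: 'a :: field_char_0) =
    fact (card A) * (fps_exp 1 - 1) ^ card B $ card A"
  using assms(2)
proof (induction B rule: finite_psubset_induct)
  case (psubset B)
  define surj where "surj C = {f \<in> A \<rightarrow>\<^sub>E C. f ` A = C}" for C :: "'c set"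
  define D :: "'a fps" where "D = fps_exp 1 - 1"
  have fin_surj: "finite (surj C)" if "C \<subseteq> B" for C
    using that assms(1) \<open>finite B\<close> finite_subset
    by (auto simp: surj_def intro!: finite_subset[of _ "A \<rightarrow>\<^sub>E C"] finite_PiE)
  have "A \<rightarrow>\<^sub>E B = (\<Union>C\<in>Pow B. surj C)"
    by (auto simp: surj_def PiE_iff extensional_def)
  then have "card (A \<rightarrow>\<^sub>E B) = (\<Sum>C\<in>Pow B. card (surj C))"
    using \<open>finite B\<close> fin_surj by (simp, intro card_UN_disjoint) (auto simp: surj_def)
  then have "(of_nat (card B ^ card A) :: 'a) = (\<Sum>C\<in>Pow B. of_nat (card (surj C)))"
    using assms(1) by (simp add: card_PiE flip: of_nat_sum)
  also have "\<dots> = of_nat (card (surj B)) + (\<Sum>C\<in>Pow B - {B}. of_nat (card (surj C)))"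
    using \<open>finite B\<close> by (intro sum.remove) auto
  also have "(\<Sum>C\<in>Pow B - {B}. of_nat (card (surj C))) =
      (\<Sum>C\<in>Pow B - {B}. fact (card A) * D ^ card C $ card A)"
    using psubset.IH by (intro sum.cong) (auto simp: surj_def D_def)
  finally have eq: "of_nat (card B ^ card A) = of_nat (card (surj B)) +
      (\<Sum>C\<in>Pow B - {B}. fact (card A) * D ^ card C $ card A)" .
  \<comment> \<open>Since \<open>D + 1\<close> is \<open>e^x\<close>, this is the binomial expansion
    of \<open>e^(|B| x)\<close>, indexed by subsets.\<close>
  have "(\<Sum>C\<in>Pow B. D ^ card C) = (\<Prod>x\<in>B. D + 1)"
    using prod_add[OF \<open>finite B\<close>, of "\<lambda>_. D" "\<lambda>_. 1"] by simp
  also have "\<dots> = fps_exp (of_nat (card B))"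
    by (simp add: D_def fps_exp_power_mult)
  finally have "(\<Sum>C\<in>Pow B. D ^ card C $ card A) = of_nat (card B) ^ card A / fact (card A)"
    by (simp add: fps_eq_iff fps_sum_nth)
  then have "of_nat (card B ^ card A) = (\<Sum>C\<in>Pow B. fact (card A) * D ^ card C $ card A)"
    by (simp add: field_simps flip: sum_distrib_left)
  also have "\<dots> = fact (card A) * D ^ card B $ card A +
      (\<Sum>C\<in>Pow B - {B}. fact (card A) * D ^ card C $ card A)"
    using \<open>finite B\<close> by (intro sum.remove) auto
  finally show ?case using eq by (simp add: surj_def D_def)
qed

text \<open>These are the compositions of \<open>n\<close> into positive parts indexed by
  \<open>B\<close>, kept extensional so that they can be counted.\<close>

definition weightings :: "'a set \<Rightarrow> nat \<Rightarrow> ('a \<Rightarrow> nat) set" where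
  "weightings B n = {c \<in> B \<rightarrow>\<^sub>E {0<..}. sum c B = n}"

lemma finite_weightings:
  assumes "finite B"
  shows "finite (weightings B n)"
proof (rule finite_subset)
  show "weightings B n \<subseteq> B \<rightarrow>\<^sub>E {..n}"
    using member_le_sum[OF _ _ assms, where 'b = nat] by (auto simp: weightings_def PiE_iff extensional_def)
qed (use assms in \<open>auto intro: finite_PiE\<close>)

text \<open>Splitting off the part at \<open>b\<close> turns the count into a convolution with the
  series of a single part.\<close>

lemma card_weightings:
  assumes "finite B"
  shows "of_nat (card (weightings B n)) = (fps_X / (1 - fps_X) :: 'a :: field fps) ^ card B $ n"
  using assms
proof (induction B arbitrary: n rule: finite_induct)
  case empty
  then show ?case by (auto simp: weightings_def PiE_def)
next
  case (insert b B)
  define F :: "'a fps" where "F = fps_X / (1 - fps_X)"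
  \<comment> \<open>The part at \<open>b\<close> is positive and bounded by the total, hence the
    range \<open>{1..n}\<close>.\<close>
  have "bij_betw (\<lambda>c. (c b, restrict c B)) (weightings (insert b B) n)
      (SIGMA i:{1..n}. weightings B (n - i))"
  proof (rule bij_betw_byWitness[where f' = "\<lambda>(i, c). c(b := i)"])
    show "\<forall>c\<in>weightings (insert b B) n. (case (c b, restrict c B) of (i, c) \<Rightarrow> c(b := i)) = c"
      by (auto simp: weightings_def PiE_iff extensional_def restrict_def fun_eq_iff)
    show "\<forall>p\<in>SIGMA i:{1..n}. weightings B (n - i).
        (\<lambda>c. (c b, restrict c B)) (case p of (i, c) \<Rightarrow> c(b := i)) = p"
      using insert.hyps
      by (auto simp: weightings_def PiE_iff extensional_def restrict_def fun_eq_iff)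
    show "(\<lambda>c. (c b, restrict c B)) ` weightings (insert b B) n
        \<subseteq> (SIGMA i:{1..n}. weightings B (n - i))"
      using insert.hyps by (auto simp: weightings_def PiE_iff Suc_le_eq)
    have "sum (c(b := i)) B = sum c B" for c :: "'b \<Rightarrow> nat" and i
      using insert.hyps by (intro sum.cong) auto
    then show "(\<lambda>(i, c). c(b := i)) ` (SIGMA i:{1..n}. weightings B (n - i))
        \<subseteq> weightings (insert b B) n"
      using insert.hyps by (auto simp: weightings_def PiE_iff extensional_def)
  qed
  then have "card (weightings (insert b B) n) = (\<Sum>i=1..n. card (weightings B (n - i)))"
    using bij_betw_same_card finite_weightings[OF insert.hyps(1)] by fastforce
  then have "of_nat (card (weightings (insert b B) n)) = (\<Sum>i=1..n. F ^ card B $ (n - i))"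
    using insert.IH by (simp add: F_def)
  \<comment> \<open>The index 0 may be added because \<open>x / (1 - x)\<close> has no constant
    term.\<close>
  also have "\<dots> = (\<Sum>i=0..n. F $ i * F ^ card B $ (n - i))"
    by (intro sum.mono_neutral_cong_left) (auto simp: F_def fps_X_div_one_minus_fps_X)
  also have "\<dots> = F ^ card (insert b B) $ n"
    using insert.hyps by (simp add: fps_mult_nth)
  finally show ?case by (simp add: F_def)
qed

subsection \<open>Enumeration\<close>

lemma Collect_isomorphic_posets_eq_iff:
  fixes P Q :: "'a rel"
  shows "Collect (isomorphic_posets P :: 'a rel \<Rightarrow> bool) = Collect (isomorphic_posets Q) \<longleftrightarrow>
    isomorphic_posets P Q"
proof
  assume "Collect (isomorphic_posets P :: 'a rel \<Rightarrow> bool) = Collect (isomorphic_posets Q)"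
  then have "Q \<in> Collect (isomorphic_posets P)" using isomorphic_posets_refl[of Q] by simp
  then show "isomorphic_posets P Q" by simp
next
  assume "isomorphic_posets P Q"
  then show "Collect (isomorphic_posets P :: 'a rel \<Rightarrow> bool) = Collect (isomorphic_posets Q)"
    using isomorphic_posets_trans[OF isomorphic_posets_sym, of P Q]
      isomorphic_posets_trans[of P Q] by (intro Collect_cong iffI)
qed

text \<open>An isomorphism is constrained only on the field. Taking the identity outside gives a
  genuine permutation of \<open>S\<close>, and for \<open>S = {1..k}\<close> there are
  \<open>fact k\<close> of these.\<close>

lemma isomorphism_extends_to_permutation:
  assumes "poset_isomorphism \<tau> Q Q'" "Field Q = S" "Field Q' = S"
  obtains \<sigma> where "\<sigma> permutes S" "Q' = map_prod \<sigma> \<sigma> ` Q" "\<And>x. x \<in> S \<Longrightarrow> \<sigma> x = \<tau> x"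
proof
  define \<sigma> where "\<sigma> x = (if x \<in> S then \<tau> x else x)" for x
  show *: "\<sigma> x = \<tau> x" if "x \<in> S" for x using that by (simp add: \<sigma>_def)
  have "bij_betw \<tau> S S" using assms by (simp add: poset_isomorphism_def)
  then have "bij_betw \<sigma> S S" using bij_betw_cong[of S \<sigma> \<tau> S] * by simp
  then show "\<sigma> permutes S" by (rule bij_imp_permutes) (simp add: \<sigma>_def)
  have "poset_isomorphism \<sigma> Q Q'"
    using assms \<open>bij_betw \<sigma> S S\<close> * by (simp add: poset_isomorphism_def)
  then show "Q' = map_prod \<sigma> \<sigma> ` Q" by (simp add: poset_isomorphism_iff_image)
qed

lemma poset_isomorphism_permutes:
  assumes "\<sigma> permutes S"
  shows "poset_isomorphism \<sigma> Q (map_prod \<sigma> \<sigma> ` Q)"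
  using assms by (auto simp: poset_isomorphism_iff_image intro: permutes_inj_on)

text \<open>The weight of an element of \<open>Q\<close> is the number of its clones, itself included.\<close>

definition weighted_blow_up :: "nat rel \<Rightarrow> (nat \<Rightarrow> nat) \<Rightarrow> nat rel" where
  "weighted_blow_up Q c =
    blow_up Q (fst \<circ> prod_decode) (prod_encode ` (SIGMA q:Field Q. {..<c q}))"

lemma finite_Field_weighted_blow_up:
  "finite (Field Q) \<Longrightarrow> finite (Field (weighted_blow_up Q c))"
  by (simp add: weighted_blow_up_def)

lemma card_Field_weighted_blow_up:
  "finite (Field Q) \<Longrightarrow> card (Field (weighted_blow_up Q c)) = sum c (Field Q)"
  by (simp add: weighted_blow_up_def card_image inj_prod_encode)

lemma image_fst_weights:
  "\<forall>q\<in>Field Q. 0 < c q \<Longrightarrow>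
    (fst \<circ> prod_decode) ` prod_encode ` (SIGMA q:Field Q. {..<c q}) = Field Q"
  by (force simp: image_iff)

text \<open>The pairs \<open>(q, i)\<close> with \<open>i < c q\<close> stand for the clones of
  \<open>q\<close>; \<open>prod_encode\<close> is injective and moves them into \<open>nat\<close>
  without identifying any.\<close>

lemma card_fibre_weights:
  assumes "q \<in> Field Q"
  shows "card {a \<in> prod_encode ` (SIGMA q:Field Q. {..<c q}). (fst \<circ> prod_decode) a = q} = c q"
proof -
  have "{a \<in> prod_encode ` (SIGMA q:Field Q. {..<c q}). (fst \<circ> prod_decode) a = q} =
      prod_encode ` ({q} \<times> {..<c q})"
    using assms by auto
  then show ?thesis by (simp add: card_image inj_prod_encode card_cartesian_product)
qed

text \<open>This is the general criterion with fibre sizes equal to the prescribed weights; their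
  positivity makes the projection onto the seed surjective.\<close>

lemma isomorphic_weighted_blow_ups_iff:
  assumes "seed Q" "\<forall>q\<in>Field Q. 0 < c q" "seed Q'" "\<forall>q\<in>Field Q'. 0 < c' q"
  shows "isomorphic_posets (weighted_blow_up Q c) (weighted_blow_up Q' c') \<longleftrightarrow>
    (\<exists>\<sigma>. poset_isomorphism \<sigma> Q Q' \<and> (\<forall>q\<in>Field Q. c' (\<sigma> q) = c q))"
proof -
  have fin: "finite (Field Q)" "finite (Field Q')"
    using assms by (auto simp: seed_def finite_poset_def)
  have "isomorphic_posets (weighted_blow_up Q c) (weighted_blow_up Q' c') \<longleftrightarrow>
    (\<exists>\<sigma>. poset_isomorphism \<sigma> Q Q' \<and>
      (\<forall>q\<in>Field Q.
        card {b \<in> prod_encode ` (SIGMA q:Field Q'. {..<c' q}). (fst \<circ> prod_decode) b = \<sigma> q} =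
        card {a \<in> prod_encode ` (SIGMA q:Field Q. {..<c q}). (fst \<circ> prod_decode) a = q}))"
    unfolding weighted_blow_up_def
    using assms fin by (intro isomorphic_blow_ups_iff image_fst_weights) auto
  also have "\<dots> \<longleftrightarrow> (\<exists>\<sigma>. poset_isomorphism \<sigma> Q Q' \<and> (\<forall>q\<in>Field Q. c' (\<sigma> q) = c q))"
  proof (intro iff_exI conj_cong refl ball_cong)
    fix \<sigma> q assume "poset_isomorphism \<sigma> Q Q'" "q \<in> Field Q"
    then have "\<sigma> q \<in> Field Q'" by (auto simp: poset_isomorphism_def bij_betw_def)
    then show "(card {b \<in> prod_encode ` (SIGMA q:Field Q'. {..<c' q}). (fst \<circ> prod_decode) b = \<sigma> q} =
        card {a \<in> prod_encode ` (SIGMA q:Field Q. {..<c q}). (fst \<circ> prod_decode) a = q}) \<longleftrightarrow>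
        c' (\<sigma> q) = c q"
      using \<open>q \<in> Field Q\<close> by (simp only: card_fibre_weights)
  qed
  finally show ?thesis .
qed

lemma finite_labelled_posets: "finite (labelled_posets X k)"
proof (rule finite_subset)
  show "labelled_posets X k \<subseteq> Pow ({1..k} \<times> {1..k})"
    by (auto simp: labelled_posets_def intro: FieldI1 FieldI2)
qed simp

section \<open>Labelled posets in the garden\<close>

context
  fixes X :: "nat rel set"
  assumes seeds: "\<forall>P\<in>X. seed P"
    and iso_closed: "\<forall>P Q. P \<in> X \<and> isomorphic_posets P Q \<longrightarrow> Q \<in> X"
begin

text \<open>Carrying the seed over to \<open>{1..k}\<close> lets \<open>labelled_posets\<close>
  count it. The bound on \<open>k\<close> holds because \<open>f\<close> is onto, and it makes the
  later sums over \<open>k\<close> stop at \<open>n\<close>.\<close>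

lemma garden_standard_blow_up:
  assumes "P \<in> garden X"
  obtains k Q f where "Q \<in> labelled_posets X k" "f ` Field P = {1..k}" "finite (Field P)"
    "P = blow_up Q f (Field P)" "k \<le> card (Field P)"
proof -
  obtain Q f where Q: "Q \<in> X" and fin: "finite (Field P)"
    and f: "f ` Field P = Field Q" "P = blow_up Q f (Field P)"
    using assms garden_iff_blow_up[OF seeds iso_closed] by blast
  define k where "k = card (Field Q)"
  have "finite (Field Q)" using fin f(1) by (metis finite_imageI)
  moreover have "card (Field Q) = card {1..k}" by (simp add: k_def)
  ultimately obtain h where h: "bij_betw h (Field Q) {1..k}"
    using finite_same_card_bij finite_atLeastAtMost by blast
  define Q2 where "Q2 = map_prod h h ` Q"
  have iso: "poset_isomorphism h Q Q2"
    using h by (simp add: poset_isomorphism_iff_image Q2_def bij_betw_def)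
  then have "Q2 \<in> X" using Q iso_closed by (auto simp: isomorphic_posets_def)
  moreover have "Field Q2 = {1..k}"
    using iso h by (simp add: poset_isomorphism_def bij_betw_def)
  ultimately have "Q2 \<in> labelled_posets X k" by (simp add: labelled_posets_def)
  moreover have "(h \<circ> f) ` Field P = {1..k}"
    using f h by (metis bij_betw_imp_surj_on image_comp)
  moreover have "P = blow_up Q2 (h \<circ> f) (Field P)"
    using blow_up_image[OF iso, of f "Field P"] f by simp
  moreover have "k \<le> card (Field P)"
    using fin f(1) card_image_le by (metis k_def)
  ultimately show ?thesis using that fin by blast
qed

text \<open>Closure of \<open>X\<close> under isomorphism lets the symmetric group act on the seeds
  with vertex set \<open>{1..k}\<close>.\<close>

lemma labelled_posets_permute:
  assumes "Q \<in> labelled_posets X k" "\<sigma> permutes {1..k}"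
  shows "map_prod \<sigma> \<sigma> ` Q \<in> labelled_posets X k"
proof -
  have iso: "poset_isomorphism \<sigma> Q (map_prod \<sigma> \<sigma> ` Q)"
    using assms(2) by (rule poset_isomorphism_permutes)
  then have "map_prod \<sigma> \<sigma> ` Q \<in> X"
    using assms(1) iso_closed unfolding labelled_posets_def isomorphic_posets_def by blast
  moreover have "Field (map_prod \<sigma> \<sigma> ` Q) = \<sigma> ` Field Q"
    using iso by (simp add: poset_isomorphism_def bij_betw_def)
  ultimately show ?thesis
    using assms permutes_image[OF assms(2)] by (simp add: labelled_posets_def)
qed

text \<open>Permutations of \<open>{1..k}\<close> act on pairs of a seed and a surjection. The pairs
  with a given blow-up form one orbit, and the action is free because a permutation is determined by
  its composite with a surjection.\<close>

lemma card_labelled_blow_ups: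
  fixes k n :: nat
  defines "B \<equiv> \<lambda>(k :: nat) (n :: nat). labelled_posets X k \<times> {f \<in> {1..n} \<rightarrow>\<^sub>E {1..k}. f ` {1..n} = {1..k}}"
  shows "card (B k n) = fact k * card ((\<lambda>(Q, f). blow_up Q f {1..n}) ` B k n)"
proof (rule card_eq_fibre_card_mult)
  show "finite (B k n)"
    unfolding B_def
    by (intro finite_cartesian_product finite_labelled_posets
        finite_subset[OF Collect_restrict] finite_PiE) auto
next
  fix x assume "x \<in> B k n"
  then obtain Q f where x: "x = (Q, f)" and Q: "Q \<in> X" "Field Q = {1..k}"
    and f: "f \<in> {1..n} \<rightarrow>\<^sub>E {1..k}" "f ` {1..n} = {1..k}"
    by (auto simp: B_def labelled_posets_def)
  \<comment> \<open>\<open>restrict\<close> keeps the relabelled surjection in the extensional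
    function space.\<close>
  define act where "act \<sigma> = (map_prod \<sigma> \<sigma> ` Q, restrict (\<sigma> \<circ> f) {1..n})" for \<sigma> :: "nat \<Rightarrow> nat"
  have "inj_on act {\<sigma>. \<sigma> permutes {1..k}}"
  proof (rule inj_onI, clarify)
    fix \<sigma> \<sigma>' assume perm: "\<sigma> permutes {1..k}" "\<sigma>' permutes {1..k}" and "act \<sigma> = act \<sigma>'"
    then have "restrict (\<sigma> \<circ> f) {1..n} i = restrict (\<sigma>' \<circ> f) {1..n} i" for i
      by (simp add: act_def)
    then have "\<sigma> (f i) = \<sigma>' (f i)" if "i \<in> {1..n}" for i
      using that by (metis comp_apply restrict_apply')
    then have "\<sigma> q = \<sigma>' q" if "q \<in> {1..k}" for q
      using that f(2) by (metis imageE)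
    then show "\<sigma> = \<sigma>'"
      using perm by (metis ext permutes_not_in)
  qed
  moreover have "act ` {\<sigma>. \<sigma> permutes {1..k}} =
      {y \<in> B k n. (\<lambda>(Q, f). blow_up Q f {1..n}) y = (\<lambda>(Q, f). blow_up Q f {1..n}) x}"
  proof (intro equalityI subsetI)
    fix y assume "y \<in> act ` {\<sigma>. \<sigma> permutes {1..k}}"
    then obtain \<sigma> where \<sigma>: "\<sigma> permutes {1..k}" "y = act \<sigma>" by auto
    have iso: "poset_isomorphism \<sigma> Q (map_prod \<sigma> \<sigma> ` Q)"
      using \<sigma> by (intro poset_isomorphism_permutes)
    have "map_prod \<sigma> \<sigma> ` Q \<in> labelled_posets X k"
      using Q \<sigma>(1) by (intro labelled_posets_permute) (simp_all add: labelled_posets_def)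
    moreover have "(\<sigma> \<circ> f) ` {1..n} = {1..k}"
      using f(2) permutes_image[OF \<sigma>(1)] by (metis image_comp)
    then have "restrict (\<sigma> \<circ> f) {1..n} \<in> {f \<in> {1..n} \<rightarrow>\<^sub>E {1..k}. f ` {1..n} = {1..k}}"
      by (auto simp del: comp_apply)
    moreover have "blow_up (map_prod \<sigma> \<sigma> ` Q) (restrict (\<sigma> \<circ> f) {1..n}) {1..n} =
        blow_up (map_prod \<sigma> \<sigma> ` Q) (\<sigma> \<circ> f) {1..n}"
      by (intro blow_up_cong) simp
    moreover have "\<dots> = blow_up Q f {1..n}"
      using f(2) Q(2) by (intro blow_up_image[OF iso]) simp
    ultimately show "y \<in> {y \<in> B k n. (\<lambda>(Q, f). blow_up Q f {1..n}) y = (\<lambda>(Q, f). blow_up Q f {1..n}) x}"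
      by (simp add: B_def \<sigma> act_def x)
  next
    fix y assume y: "y \<in> {y \<in> B k n. (\<lambda>(Q, f). blow_up Q f {1..n}) y = (\<lambda>(Q, f). blow_up Q f {1..n}) x}"
    then obtain Q' f' where y': "y = (Q', f')" and Q': "Q' \<in> X" "Field Q' = {1..k}"
      and f': "f' \<in> {1..n} \<rightarrow>\<^sub>E {1..k}" "f' ` {1..n} = {1..k}"
      and eq: "blow_up Q f {1..n} = blow_up Q' f' {1..n}"
      by (auto simp: B_def labelled_posets_def x)
    \<comment> \<open>Two presentations of one labelled poset differ by an isomorphism of seeds,
      whose extension to a permutation is the group element sought.\<close>
    obtain \<tau> where \<tau>: "poset_isomorphism \<tau> Q Q'" "\<And>a. a \<in> {1..n} \<Longrightarrow> f' a = \<tau> (f a)"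
      using poset_isomorphism_of_blow_up_eq[OF _ _ _ _ eq] Q Q' f(2) f'(2) seeds by metis
    obtain \<sigma> where \<sigma>: "\<sigma> permutes {1..k}" "Q' = map_prod \<sigma> \<sigma> ` Q" "\<And>q. q \<in> {1..k} \<Longrightarrow> \<sigma> q = \<tau> q"
      using isomorphism_extends_to_permutation[OF \<tau>(1) Q(2) Q'(2)] by metis
    have "f' = restrict (\<sigma> \<circ> f) {1..n}"
    proof (rule extensionalityI)
      show "f' \<in> extensional {1..n}" using f' by (simp add: PiE_def)
      show "f' i = restrict (\<sigma> \<circ> f) {1..n} i" if "i \<in> {1..n}" for i
      proof -
        have "f i \<in> {1..k}" using that f(2) by blast
        then show ?thesis using \<tau>(2)[OF that] \<sigma>(3) that by simp
      qed
    qed simp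
    then show "y \<in> act ` {\<sigma>. \<sigma> permutes {1..k}}" using \<sigma> y' by (auto simp: act_def)
  qed
  moreover have card_perms: "card {\<sigma>. \<sigma> permutes {1..k}} = fact k"
    by (rule card_permutations) simp_all
  ultimately show "card {y \<in> B k n. (\<lambda>(Q, f). blow_up Q f {1..n}) y = (\<lambda>(Q, f). blow_up Q f {1..n}) x} = fact k"
    by (metis card_image card_perms)
qed

text \<open>Sprouts are grouped by the size \<open>k\<close> of the seed. A sprout determines its
  seed up to isomorphism, so the groups are disjoint.\<close>

lemma card_labelled_posets_garden:
  fixes n :: nat
  defines "B \<equiv> \<lambda>(k :: nat) (n :: nat). labelled_posets X k \<times> {f \<in> {1..n} \<rightarrow>\<^sub>E {1..k}. f ` {1..n} = {1..k}}"
  shows "card (labelled_posets (garden X) n) =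
    (\<Sum>k=0..n. card ((\<lambda>(Q, f). blow_up Q f {1..n}) ` B k n))"
proof -
  have "labelled_posets (garden X) n = (\<Union>k\<in>{0..n}. (\<lambda>(Q, f). blow_up Q f {1..n}) ` B k n)"
  proof (intro equalityI subsetI)
    fix P assume "P \<in> labelled_posets (garden X) n"
    then have P: "P \<in> garden X" "Field P = {1..n}" by (auto simp: labelled_posets_def)
    obtain k Q f where k: "Q \<in> labelled_posets X k" "f ` {1..n} = {1..k}"
        "P = blow_up Q f {1..n}" "k \<le> n"
      using garden_standard_blow_up[OF P(1)] P(2) by (metis card_atLeastAtMost diff_Suc_1)
    then have "(Q, restrict f {1..n}) \<in> B k n" by (auto simp: B_def)
    moreover have "P = blow_up Q (restrict f {1..n}) {1..n}"
      unfolding k(3) by (intro blow_up_cong) simp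
    ultimately show "P \<in> (\<Union>k\<in>{0..n}. (\<lambda>(Q, f). blow_up Q f {1..n}) ` B k n)"
      using k(4) by force
  next
    fix P assume "P \<in> (\<Union>k\<in>{0..n}. (\<lambda>(Q, f). blow_up Q f {1..n}) ` B k n)"
    then obtain k Q f where "(Q, f) \<in> B k n" "P = blow_up Q f {1..n}" by auto
    then have "Q \<in> X" "f ` Field P = Field Q" "P = blow_up Q f (Field P)" "Field P = {1..n}"
      by (auto simp: B_def labelled_posets_def)
    moreover have "finite (Field P)" using \<open>Field P = {1..n}\<close> by simp
    ultimately show "P \<in> labelled_posets (garden X) n"
      using garden_iff_blow_up[OF seeds iso_closed, of P] unfolding labelled_posets_def by blast
  qed
  moreover have "(\<lambda>(Q, f). blow_up Q f {1..n}) ` B k n \<inter> (\<lambda>(Q, f). blow_up Q f {1..n}) ` B k' n = {}"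
    if "k \<noteq> k'" for k k'
  proof (rule ccontr)
    assume "\<not> ?thesis"
    then obtain Q f Q' f' where "(Q, f) \<in> B k n" "(Q', f') \<in> B k' n"
      and eq: "blow_up Q f {1..n} = blow_up Q' f' {1..n}" by fastforce
    then have "Q \<in> X" "Field Q = {1..k}" "f ` {1..n} = {1..k}"
        "Q' \<in> X" "Field Q' = {1..k'}" "f' ` {1..n} = {1..k'}"
      by (auto simp: B_def labelled_posets_def)
    then obtain \<tau> where "poset_isomorphism \<tau> Q Q'"
      using poset_isomorphism_of_blow_up_eq[OF _ _ _ _ eq] seeds by metis
    then have "card (Field Q) = card (Field Q')"
      by (intro isomorphic_posets_card) (auto simp: isomorphic_posets_def)
    then show False using that \<open>Field Q = {1..k}\<close> \<open>Field Q' = {1..k'}\<close> by simp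
  qed
  moreover have "finite (B k n)" for k
    unfolding B_def
    by (intro finite_cartesian_product finite_labelled_posets
        finite_subset[OF Collect_restrict] finite_PiE) auto
  ultimately show ?thesis by (simp add: card_UN_disjoint)
qed

text \<open>The orbit size \<open>fact k\<close> becomes the denominator in \<open>egf X\<close>,
  and the factor \<open>fact n\<close> from counting surjections cancels the one in
  \<open>egf (garden X)\<close>.\<close>

lemma egf_garden: "egf (garden X) = egf X oo (fps_exp 1 - 1)"
proof (rule fps_ext)
  fix n :: nat
  define s where "s k = (of_nat (card (labelled_posets X k)) :: rat)" for k
  define B where "B k = labelled_posets X k \<times> {f \<in> {1..n} \<rightarrow>\<^sub>E {1..k}. f ` {1..n} = {1..k}}" for k
  have "of_nat (card ((\<lambda>(Q, f). blow_up Q f {1..n}) ` B k)) =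
      s k / fact k * (fact n * (fps_exp 1 - 1) ^ k $ n)" for k
  proof -
    have "of_nat (card (B k)) = s k * (fact n * (fps_exp 1 - 1) ^ k $ n)"
      using card_surjections[OF finite_atLeastAtMost finite_atLeastAtMost, of 1 n 1 k, where 'a = rat]
      by (simp only: B_def s_def card_cartesian_product of_nat_mult card_atLeastAtMost diff_Suc_1)
    moreover have "card (B k) = fact k * card ((\<lambda>(Q, f). blow_up Q f {1..n}) ` B k)"
      unfolding B_def by (rule card_labelled_blow_ups)
    ultimately show ?thesis by (simp add: field_simps)
  qed
  moreover have "card (labelled_posets (garden X) n) =
      (\<Sum>k=0..n. card ((\<lambda>(Q, f). blow_up Q f {1..n}) ` B k))"
    unfolding B_def by (rule card_labelled_posets_garden)
  ultimately have "(of_nat (card (labelled_posets (garden X) n)) :: rat) =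
      (\<Sum>k=0..n. s k / fact k * (fact n * (fps_exp 1 - 1) ^ k $ n))"
    by simp
  also have "\<dots> = fact n * (\<Sum>k=0..n. s k / fact k * (fps_exp 1 - 1) ^ k $ n)"
    by (simp add: sum_distrib_left mult_ac)
  finally show "egf (garden X) $ n = (egf X oo (fps_exp 1 - 1)) $ n"
    by (simp add: egf_def fps_compose_nth s_def)
qed

section \<open>Isomorphism classes in the garden\<close>

lemma weighted_blow_up_class_eq_iff:
  assumes "Q \<in> labelled_posets X k" "c \<in> weightings {1..k} n"
    and "Q' \<in> labelled_posets X k'" "c' \<in> weightings {1..k'} n"
  shows "(Collect (isomorphic_posets (weighted_blow_up Q c)) :: nat rel set) =
      Collect (isomorphic_posets (weighted_blow_up Q' c')) \<longleftrightarrow>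
    (\<exists>\<sigma>. poset_isomorphism \<sigma> Q Q' \<and> (\<forall>q\<in>{1..k}. c' (\<sigma> q) = c q))"
proof -
  have "(Collect (isomorphic_posets (weighted_blow_up Q c)) :: nat rel set) =
      Collect (isomorphic_posets (weighted_blow_up Q' c')) \<longleftrightarrow>
      isomorphic_posets (weighted_blow_up Q c) (weighted_blow_up Q' c')"
    by (rule Collect_isomorphic_posets_eq_iff)
  also have "\<dots> \<longleftrightarrow> (\<exists>\<sigma>. poset_isomorphism \<sigma> Q Q' \<and> (\<forall>q\<in>Field Q. c' (\<sigma> q) = c q))"
    using assms seeds
    by (intro isomorphic_weighted_blow_ups_iff)
      (auto simp: labelled_posets_def weightings_def PiE_iff)
  finally show ?thesis using assms(1) by (simp add: labelled_posets_def)
qed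

text \<open>Up to isomorphism a blow-up depends only on its seed and its fibre sizes, so each class
  contains a weighted blow-up of a standard seed.\<close>

lemma iso_classes_garden:
  "iso_classes (garden X) n = (\<Union>k\<in>{0..n}.
    (\<lambda>(Q, c). Collect (isomorphic_posets (weighted_blow_up Q c))) `
      (labelled_posets X k \<times> weightings {1..k} n))"
    (is "_ = (\<Union>k\<in>{0..n}. ?cls ` (?B k))")
proof -
  \<comment> \<open>The quotient takes images under the full isomorphism relation, so a class is a
    whole \<open>Collect (isomorphic_posets P)\<close>.\<close>
  have classes: "iso_classes (garden X) n =
      (\<lambda>P. Collect (isomorphic_posets P)) ` {P \<in> garden X. card (Field P) = n}"
    by (auto simp: iso_classes_def quotient_def Image_def)
  show ?thesis
    unfolding classes
  proof (intro equalityI subsetI)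
    fix K :: "nat rel set" assume "K \<in> (\<lambda>P. Collect (isomorphic_posets P)) ` {P \<in> garden X. card (Field P) = n}"
    then obtain P where P: "P \<in> garden X" "card (Field P) = n" "K = Collect (isomorphic_posets P)"
      by auto
    obtain k Q f where k: "Q \<in> labelled_posets X k" "f ` Field P = {1..k}" "finite (Field P)"
        "P = blow_up Q f (Field P)" "k \<le> n"
      using garden_standard_blow_up[OF P(1)] P(2) by metis
    have Q: "seed Q" "Field Q = {1..k}" using k(1) seeds by (auto simp: labelled_posets_def)
    \<comment> \<open>The weights are the numbers of clones in \<open>P\<close>, positive because
      \<open>f\<close> is onto.\<close>
    define c where "c = (\<lambda>q\<in>{1..k}. card {a \<in> Field P. f a = q})"
    have pos: "0 < c q" if "q \<in> {1..k}" for q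
    proof -
      have "q \<in> f ` Field P" using k(2) that by simp
      then have "{a \<in> Field P. f a = q} \<noteq> {}" by auto
      then show ?thesis using k(3) that by (simp add: c_def card_gt_0_iff)
    qed
    have "sum c {1..k} = (\<Sum>q\<in>{1..k}. card {a \<in> Field P. f a = q})"
      by (simp add: c_def)
    also have "\<dots> = n"
      using sum.image_gen[OF k(3), of "\<lambda>_. 1::nat" f] k(2) P(2) by simp
    finally have c: "c \<in> weightings {1..k} n"
      using pos by (auto simp: weightings_def PiE_iff c_def)
    have "isomorphic_posets (blow_up Q f (Field P)) (weighted_blow_up Q c)"
      unfolding weighted_blow_up_def
    proof (subst isomorphic_blow_ups_iff)
      show "(fst \<circ> prod_decode) ` prod_encode ` (SIGMA q:Field Q. {..<c q}) = Field Q"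
        using pos Q(2) by (intro image_fst_weights) simp
      \<comment> \<open>Both blow-ups have the seed \<open>Q\<close>, so the identity serves as
        \<open>\<sigma>\<close>.\<close>
      show "\<exists>\<sigma>. poset_isomorphism \<sigma> Q Q \<and> (\<forall>q\<in>Field Q.
          card {b \<in> prod_encode ` (SIGMA q:Field Q. {..<c q}). (fst \<circ> prod_decode) b = \<sigma> q} =
          card {a \<in> Field P. f a = q})"
        using card_fibre_weights[of _ Q c] Q(2)
        by (intro exI[of _ id]) (auto simp: poset_isomorphism_def c_def)
    qed (use k Q in auto)
    then have "isomorphic_posets P (weighted_blow_up Q c)" using k(4) by simp
    then have "K = ?cls (Q, c)"
      unfolding P(3) prod.case using isomorphic_posets_sym isomorphic_posets_trans by blast
    then show "K \<in> (\<Union>k\<in>{0..n}. ?cls ` (?B k))" using k(1,5) c by force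
  next
    fix K :: "nat rel set" assume "K \<in> (\<Union>k\<in>{0..n}. ?cls ` (?B k))"
    then obtain k Q c where Q: "Q \<in> X" "Field Q = {1..k}" and c: "c \<in> weightings {1..k} n"
      and K: "K = ?cls (Q, c)" by (auto simp: labelled_posets_def)
    have card: "card (Field (weighted_blow_up Q c)) = n"
      using card_Field_weighted_blow_up[of Q c] Q c by (simp add: weightings_def)
    have "(fst \<circ> prod_decode) ` Field (weighted_blow_up Q c) = Field Q"
      unfolding weighted_blow_up_def Field_blow_up
      using Q(2) c by (intro image_fst_weights) (auto simp: weightings_def PiE_iff)
    moreover have "weighted_blow_up Q c =
        blow_up Q (fst \<circ> prod_decode) (Field (weighted_blow_up Q c))"
      by (simp add: weighted_blow_up_def)
    moreover have "finite (Field (weighted_blow_up Q c))"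
      using Q by (intro finite_Field_weighted_blow_up) simp
    ultimately have "weighted_blow_up Q c \<in> garden X"
      using garden_iff_blow_up[OF seeds iso_closed] Q(1) by blast
    then show "K \<in> (\<lambda>P. Collect (isomorphic_posets P)) ` {P \<in> garden X. card (Field P) = n}"
      using card K by auto
  qed
qed

text \<open>Primitivity makes the symmetric group act freely on weighted seeds with vertex set \<open>{1..k}\<close>.\<close>

lemma card_weighted_blow_up_classes:
  assumes primitive: "\<forall>P\<in>X. primitive P"
  shows "card (labelled_posets X k \<times> weightings {1..k} n) = fact k *
    card ((\<lambda>(Q, c). Collect (isomorphic_posets (weighted_blow_up Q c)) :: nat rel set) `
      (labelled_posets X k \<times> weightings {1..k} n))"
    (is "card ?B = _ * card (?cls ` ?B)")
proof (rule card_eq_fibre_card_mult)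
  show "finite ?B"
    by (intro finite_cartesian_product finite_labelled_posets finite_weightings) auto
next
  fix x assume "x \<in> ?B"
  then obtain Q c where x: "x = (Q, c)" and Q: "Q \<in> labelled_posets X k" "Q \<in> X" "Field Q = {1..k}"
    and c: "c \<in> weightings {1..k} n"
    by (auto simp: labelled_posets_def)
  \<comment> \<open>Weights travel with the vertices: with the inverse, the new weight of
    \<open>\<sigma> q\<close> is \<open>c q\<close>.\<close>
  define act where "act \<sigma> = (map_prod \<sigma> \<sigma> ` Q, restrict (c \<circ> inv \<sigma>) {1..k})" for \<sigma>
  have "inj_on act {\<sigma>. \<sigma> permutes {1..k}}"
  proof (rule inj_onI, clarify)
    fix \<sigma> \<sigma>' assume perm: "\<sigma> permutes {1..k}" "\<sigma>' permutes {1..k}" and "act \<sigma> = act \<sigma>'"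
    then have "map_prod \<sigma> \<sigma> ` Q = map_prod \<sigma>' \<sigma>' ` Q" by (simp add: act_def)
    then have iso: "poset_isomorphism \<sigma> Q (map_prod \<sigma> \<sigma> ` Q)"
        "poset_isomorphism \<sigma>' Q (map_prod \<sigma> \<sigma> ` Q)"
      using perm poset_isomorphism_permutes by metis+
    \<comment> \<open>Two permutations with the same relabelled seed differ by an automorphism of
      \<open>Q\<close>, which primitivity forces to be the identity.\<close>
    have "poset_isomorphism (inv_into (Field Q) \<sigma> \<circ> \<sigma>') Q Q"
      using iso poset_isomorphism_comp poset_isomorphism_inv by blast
    then have *: "inv_into (Field Q) \<sigma> (\<sigma>' q) = q" if "q \<in> Field Q" for q
      using primitive Q(2) that unfolding primitive_def by (metis comp_apply)
    have "\<sigma>' q = \<sigma> q" if "q \<in> {1..k}" for q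
    proof -
      have "\<sigma>' q \<in> \<sigma> ` Field Q"
        using that permutes_image[OF perm(1)] permutes_image[OF perm(2)] Q(3) by blast
      then show ?thesis using * that Q(3) by (metis f_inv_into_f)
    qed
    then show "\<sigma> = \<sigma>'" using perm by (metis ext permutes_not_in)
  qed
  \<comment> \<open>The orbit of \<open>(Q, c)\<close> consists of the weighted seeds with
    isomorphic blow-ups, since such an isomorphism induces a weight-preserving isomorphism of
    seeds.\<close>
  moreover have "act ` {\<sigma>. \<sigma> permutes {1..k}} = {y \<in> ?B. ?cls y = ?cls x}"
  proof (intro equalityI subsetI)
    fix y assume "y \<in> act ` {\<sigma>. \<sigma> permutes {1..k}}"
    then obtain \<sigma> where \<sigma>: "\<sigma> permutes {1..k}" "y = act \<sigma>" by auto
    define Q' where "Q' = map_prod \<sigma> \<sigma> ` Q"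
    define c' where "c' = restrict (c \<circ> inv \<sigma>) {1..k}"
    have iso: "poset_isomorphism \<sigma> Q Q'"
      unfolding Q'_def using \<sigma> by (intro poset_isomorphism_permutes)
    have Q': "Q' \<in> labelled_posets X k"
      unfolding Q'_def using Q(1) \<sigma>(1) by (rule labelled_posets_permute)
    have inv: "inv \<sigma> permutes {1..k}" using \<sigma>(1) by (rule permutes_inv)
    have "sum c' {1..k} = sum (c \<circ> inv \<sigma>) {1..k}" by (simp add: c'_def)
    also have "\<dots> = sum c {1..k}" by (rule sum.permute[OF inv, symmetric])
    finally have c': "c' \<in> weightings {1..k} n"
      using c permutes_in_image[OF inv] by (auto simp: weightings_def PiE_iff c'_def)
    have "c' (\<sigma> q) = c q" if "q \<in> {1..k}" for q
      using that permutes_in_image[OF \<sigma>(1), of q] permutes_inverses(2)[OF \<sigma>(1)]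
      by (simp add: c'_def)
    then have "?cls (Q, c) = ?cls (Q', c')"
      using iso unfolding prod.case weighted_blow_up_class_eq_iff[OF Q(1) c Q' c'] by blast
    moreover have "y = (Q', c')" by (simp add: \<sigma>(2) act_def Q'_def c'_def)
    ultimately show "y \<in> {y \<in> ?B. ?cls y = ?cls x}"
      using Q' c' x by simp
  next
    fix y assume "y \<in> {y \<in> ?B. ?cls y = ?cls x}"
    then obtain Q' c' where y: "y = (Q', c')" and Q': "Q' \<in> labelled_posets X k" "Field Q' = {1..k}"
      and c': "c' \<in> weightings {1..k} n" and eq: "?cls (Q, c) = ?cls (Q', c')"
      by (auto simp: labelled_posets_def x)
    obtain \<tau> where \<tau>: "poset_isomorphism \<tau> Q Q'" "\<forall>q\<in>{1..k}. c' (\<tau> q) = c q"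
      using eq unfolding prod.case weighted_blow_up_class_eq_iff[OF Q(1) c Q'(1) c'] by blast
    obtain \<sigma> where \<sigma>: "\<sigma> permutes {1..k}" "Q' = map_prod \<sigma> \<sigma> ` Q" "\<And>q. q \<in> {1..k} \<Longrightarrow> \<sigma> q = \<tau> q"
      using isomorphism_extends_to_permutation[OF \<tau>(1) Q(3) Q'(2)] by metis
    have "c' = restrict (c \<circ> inv \<sigma>) {1..k}"
    proof (rule extensionalityI)
      show "c' \<in> extensional {1..k}" using c' by (simp add: weightings_def PiE_def)
      show "c' q = restrict (c \<circ> inv \<sigma>) {1..k} q" if "q \<in> {1..k}" for q
      proof -
        have "inv \<sigma> q \<in> {1..k}"
          using that permutes_in_image[OF permutes_inv[OF \<sigma>(1)]] by blast
        then have "c' (\<sigma> (inv \<sigma> q)) = c (inv \<sigma> q)" using \<tau>(2) \<sigma>(3) by metis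
        then show ?thesis using that permutes_inverses(1)[OF \<sigma>(1)] by simp
      qed
    qed simp
    then show "y \<in> act ` {\<sigma>. \<sigma> permutes {1..k}}" using \<sigma> y by (auto simp: act_def)
  qed
  moreover have card_perms: "card {\<sigma>. \<sigma> permutes {1..k}} = fact k"
    by (rule card_permutations) simp_all
  ultimately show "card {y \<in> ?B. ?cls y = ?cls x} = fact k"
    by (metis card_image card_perms)
qed

text \<open>Free orbits of weighted seeds again contribute \<open>fact k\<close>. A class remembers
  no vertex labels, so compositions of \<open>n\<close> take the place of surjections and no
  \<open>fact n\<close> occurs.\<close>

lemma ogf_garden:
  assumes primitive: "\<forall>P\<in>X. primitive P"
  shows "ogf (garden X) = egf X oo (fps_X / (1 - fps_X))"
proof (rule fps_ext)
  fix n :: nat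
  define s where "s k = (of_nat (card (labelled_posets X k)) :: rat)" for k
  define F where "F = (fps_X / (1 - fps_X) :: rat fps)"
  define B where "B k = labelled_posets X k \<times> weightings {1..k} n" for k
  define cls where "cls = (\<lambda>(Q, c). Collect (isomorphic_posets (weighted_blow_up Q c)) :: nat rel set)"
  have card: "of_nat (card (cls ` B k)) = s k / fact k * F ^ k $ n" for k
  proof -
    have "of_nat (card (B k)) = s k * F ^ k $ n"
      using card_weightings[OF finite_atLeastAtMost, of 1 k n, where 'a = rat]
      by (simp only: B_def s_def F_def card_cartesian_product of_nat_mult card_atLeastAtMost diff_Suc_1)
    moreover have "card (B k) = fact k * card (cls ` B k)"
      unfolding B_def cls_def by (rule card_weighted_blow_up_classes[OF primitive])
    ultimately show ?thesis by (simp add: field_simps)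
  qed
  \<comment> \<open>Isomorphic blow-ups have isomorphic seeds, hence seeds of the same size.\<close>
  have disj: "cls ` B k \<inter> cls ` B k' = {}" if "k \<noteq> k'" for k k'
  proof (rule ccontr)
    assume "\<not> ?thesis"
    then obtain Q c Q' c' where *: "(Q, c) \<in> B k" "(Q', c') \<in> B k'" "cls (Q, c) = cls (Q', c')"
      by fastforce
    then have "\<exists>\<sigma>. poset_isomorphism \<sigma> Q Q'"
      using weighted_blow_up_class_eq_iff[of Q k c n Q' k' c'] by (auto simp: B_def cls_def)
    then have "card (Field Q) = card (Field Q')"
      by (intro isomorphic_posets_card) (auto simp: isomorphic_posets_def)
    then show False using that * by (auto simp: B_def labelled_posets_def)
  qed
  have fin: "finite (B k)" for k
    unfolding B_def by (intro finite_cartesian_product finite_labelled_posets finite_weightings) auto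
  have "iso_classes (garden X) n = (\<Union>k\<in>{0..n}. cls ` B k)"
    using iso_classes_garden by (simp add: B_def cls_def)
  also have "card \<dots> = (\<Sum>k=0..n. card (cls ` B k))"
    using disj fin by (intro card_UN_disjoint) auto
  finally show "ogf (garden X) $ n = (egf X oo (fps_X / (1 - fps_X))) $ n"
    by (simp add: ogf_def egf_def fps_compose_nth card s_def F_def)
qed

end

section \<open>Change of variable between the two series\<close>

lemma fps_X_div_one_minus_fps_X_compose:
  "fps_X / (1 - fps_X) oo (1 - fps_exp (- 1)) = (fps_exp 1 - 1 :: 'a :: field_char_0 fps)"
proof -
  \<comment> \<open>Substitution acts on numerator and denominator separately; the resulting
    \<open>(1 - e^(-x)) / e^(-x)\<close> simplifies to \<open>e^x - 1\<close>.\<close>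
  have "fps_X / (1 - fps_X) oo (1 - fps_exp (- 1)) =
      (fps_X oo (1 - fps_exp (- 1))) / ((1 - fps_X) oo (1 - fps_exp (- 1)) :: 'a fps)"
    by (rule fps_divide_compose) simp_all
  also have "\<dots> = (1 - fps_exp (- 1)) / fps_exp (- 1)"
    by (simp add: fps_compose_sub_distrib)
  also have "\<dots> = (1 - fps_exp (- 1)) * inverse (fps_exp (- 1))"
    by (rule fps_divide_unit) simp
  also have "inverse (fps_exp (- 1)) = (fps_exp 1 :: 'a fps)"
    using fps_exp_neg[of "- 1 :: 'a"] by simp
  also have "(1 - fps_exp (- 1)) * fps_exp 1 = (fps_exp 1 - 1 :: 'a fps)"
    using fps_exp_add_mult[of "- 1 :: 'a" 1] by (simp add: left_diff_distrib)
  finally show ?thesis .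
qed

theorem theorem4p1:
  fixes X G :: "nat rel set" and Eg Og Sg :: "rat fps"
  assumes seeds: "\<forall>P\<in>X. seed P"
    and iso_closed: "\<forall>P Q. P \<in> X \<and> isomorphic_posets P Q \<longrightarrow> Q \<in> X"
    and primitive: "\<forall>P\<in>X. primitive P"
  defines "G \<equiv> garden X"
  defines "Og \<equiv> ogf G" and "Eg \<equiv> egf G" and "Sg \<equiv> egf X"
  shows "Eg = Sg oo (fps_exp 1 - 1) \<and>
         Eg = Og oo (1 - fps_exp (- 1)) \<and>
         Og = Sg oo (fps_X / (1 - fps_X))"
proof -
  have egf_eq: "Eg = Sg oo (fps_exp 1 - 1)"
    unfolding Eg_def Sg_def G_def using seeds iso_closed by (rule egf_garden)
  have ogf_eq: "Og = Sg oo (fps_X / (1 - fps_X))"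
    unfolding Og_def Sg_def G_def using seeds iso_closed primitive by (rule ogf_garden)
  \<comment> \<open>Substituting \<open>1 - e^(-x)\<close> into the identity for \<open>Og\<close>
    yields the one relating \<open>Eg\<close> and \<open>Og\<close>. Composition is associative here
    because both inner series have zero constant term.\<close>
  have "Og oo (1 - fps_exp (- 1)) = Sg oo (fps_X / (1 - fps_X) oo (1 - fps_exp (- 1)))"
    unfolding ogf_eq by (rule fps_compose_assoc[symmetric]) (simp_all add: fps_X_div_one_minus_fps_X)
  then show ?thesis
    using egf_eq ogf_eq by (simp add: fps_X_div_one_minus_fps_X_compose)
qed

end
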